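(* Let $G$ be a finitely generated virtually abelian group, let $S$ be any finite generating set of $G$, and let $N$ be a torsion-free abelian normal subgroup of finite index in $G$. Let $\varphi\in\operatorname{End}(G)$ with $\varphi(N)\subset N$. If $G/N$ is abelian and the endomorphism $\overline{\varphi}\in\operatorname{End}(G/N)$ induced by $\varphi$ is the identity on $G/N$, then for any $g_0\in G$ it holds that $$\beta_{[g_0]_\varphi\subset G}^S(r)=\Theta\big(r^{\operatorname{rank}(\operatorname{Id}_N-\tau_{g_0}\circ\varphi|_N)}\big)\quad\text{as } r\to\infty.$$
   Context: For a group $G$ with finite generating set $S$, the word length $|g|_S$ of $g\in G$ is the minimal $k\in\mathbb{N}=\{0,1,2,\dots\}$ such that $g=s_1\cdots s_k$ with $s_i\in S\cup S^{-1}$. For a subset $U\subset G$, the subset growth of $U$ in $G$ is $\beta_{U\subset G}^S(r)=\#\{u\in U : |u|_S\le r\}$ for $r\in\mathbb{R}_{\ge0}$. For $\varphi\in\operatorname{End}(G)$, elements $g,h\in G$ are $\varphi$-twisted conjugate if there is $z\in G$ with $g=zh\varphi(z)^{-1}$. This is an equivalence relation; the class of $g$ is denoted $[g]_\varphi$. For $g\in G$, $\tau_g:G\to G:h\mapsto ghg^{-1}$. Here $N\cong\mathbb{Z}^{\operatorname{rank}(N)}$ is written additively in $\operatorname{Id}_N-\tau_g\circ\varphi|_N\in\operatorname{End}(N)$, and the rank of an endomorphism of $N$ is the rank of its image. For non-negative functions $f,g$, $f(r)=\Theta(g(r))$ as $r\to\infty$ means that there are $c_1,c_2>0$ and $n_0\in\mathbb{N}_{>0}$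 such that $c_1g(r)\le f(r)\le c_2g(r)$ for all $r\ge n_0$. *)

theory Defs
  imports "HOL-Algebra.Algebra" "HOL-Library.Landau_Symbols"
begin

definition finite_generating_set :: "('a, 'b) monoid_scheme \<Rightarrow> 'a set \<Rightarrow> bool" where
  "finite_generating_set G S \<longleftrightarrow>
     finite S \<and> S \<subseteq> carrier G \<and> generate G S = carrier G"

definition finitely_generated :: "('a, 'b) monoid_scheme \<Rightarrow> bool" where
  "finitely_generated G \<longleftrightarrow> (\<exists>S. finite_generating_set G S)"

definition finite_index :: "('a, 'b) monoid_scheme \<Rightarrow> 'a set \<Rightarrow> bool" where
  "finite_index G H \<longleftrightarrow> finite (rcosets\<^bsub>G\<^esub> H)"

definition virtually_abelian :: "('a, 'b) monoid_scheme \<Rightarrow> bool" where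
  "virtually_abelian G \<longleftrightarrow>
     (\<exists>H. subgroup H G \<and> comm_group (G\<lparr>carrier := H\<rparr>) \<and> finite_index G H)"

definition torsion_free :: "('a, 'b) monoid_scheme \<Rightarrow> bool" where
  "torsion_free G \<longleftrightarrow>
     (\<forall>x\<in>carrier G. \<forall>n::nat. n > 0 \<and> x [^]\<^bsub>G\<^esub> n = \<one>\<^bsub>G\<^esub> \<longrightarrow> x = \<one>\<^bsub>G\<^esub>)"

text \<open>The value of \<open>LEAST\<close> is unspecified unless \<open>g\<close> lies in the subgroup generated by \<open>S\<close>.\<close>

definition word_length :: "('a, 'b) monoid_scheme \<Rightarrow> 'a set \<Rightarrow> 'a \<Rightarrow> nat" where
  "word_length G S g =
     (LEAST k. \<exists>ws. length ws = k \<and> set ws \<subseteq> S \<union> set_inv\<^bsub>G\<^esub> S \<and>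
                    foldr (\<otimes>\<^bsub>G\<^esub>) ws \<one>\<^bsub>G\<^esub> = g)"

text \<open>The counted set is finite whenever \<open>S\<close> is a finite generating set and
  \<open>U \<subseteq> carrier G\<close>, so \<open>card\<close> is then the true cardinality.\<close>

definition subset_growth ::
    "('a, 'b) monoid_scheme \<Rightarrow> 'a set \<Rightarrow> 'a set \<Rightarrow> real \<Rightarrow> nat" where
  "subset_growth G S U r = card {u \<in> U. real (word_length G S u) \<le> r}"

definition twisted_conjugate ::
    "('a, 'b) monoid_scheme \<Rightarrow> ('a \<Rightarrow> 'a) \<Rightarrow> 'a \<Rightarrow> 'a \<Rightarrow> bool" where
  "twisted_conjugate G \<phi> g h \<longleftrightarrow>
     (\<exists>z\<in>carrier G. g = z \<otimes>\<^bsub>G\<^esub> h \<otimes>\<^bsub>G\<^esub> inv\<^bsub>G\<^esub> (\<phi> z))"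

definition twisted_class ::
    "('a, 'b) monoid_scheme \<Rightarrow> ('a \<Rightarrow> 'a) \<Rightarrow> 'a \<Rightarrow> 'a set" where
  "twisted_class G \<phi> g = {h \<in> carrier G. twisted_conjugate G \<phi> h g}"

text \<open>For \<open>\<phi> \<in> hom G G\<close> with \<open>\<phi> ` N \<subseteq> N\<close> the set of cosets below is a singleton, and
  the map sends \<open>N #>\<^bsub>G\<^esub> x\<close> to \<open>N #>\<^bsub>G\<^esub> \<phi> x\<close>.\<close>

definition induced_endo ::
    "('a, 'b) monoid_scheme \<Rightarrow> 'a set \<Rightarrow> ('a \<Rightarrow> 'a) \<Rightarrow> 'a set \<Rightarrow> 'a set" where
  "induced_endo G N \<phi> C = the_elem ((\<lambda>x. N #>\<^bsub>G\<^esub> \<phi> x) ` C)"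

definition inner_aut :: "('a, 'b) monoid_scheme \<Rightarrow> 'a \<Rightarrow> 'a \<Rightarrow> 'a" where
  "inner_aut G g h = g \<otimes>\<^bsub>G\<^esub> h \<otimes>\<^bsub>G\<^esub> inv\<^bsub>G\<^esub> g"

text \<open>The pointwise difference of two endomorphisms, \<open>\<alpha> - \<beta>\<close> in additive notation.\<close>

definition endo_diff ::
    "('a, 'b) monoid_scheme \<Rightarrow> ('a \<Rightarrow> 'a) \<Rightarrow> ('a \<Rightarrow> 'a) \<Rightarrow> 'a \<Rightarrow> 'a" where
  "endo_diff G \<alpha> \<beta> x = \<alpha> x \<otimes>\<^bsub>G\<^esub> inv\<^bsub>G\<^esub> (\<beta> x)"

text \<open>The rank of a free abelian group of finite rank: the unique \<open>n\<close> such that the group is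
  isomorphic to \<open>\<int>\<^sup>n\<close>. Unspecified for other groups.\<close>

definition free_rank :: "('a, 'b) monoid_scheme \<Rightarrow> nat" where
  "free_rank A = (THE n. A \<cong> free_Abelian_group {..<n})"

definition endo_rank :: "('a, 'b) monoid_scheme \<Rightarrow> 'a set \<Rightarrow> ('a \<Rightarrow> 'a) \<Rightarrow> nat" where
  "endo_rank G N \<psi> = free_rank (G\<lparr>carrier := \<psi> ` N\<rparr>)"

end

theory Submission
  imports Defs
begin

text \<open>Write \<open>\<psi> = Id - \<tau> \<circ> \<phi>\<close> on \<open>N\<close>, where \<open>\<tau>\<close> is conjugation by \<open>g\<^sub>0\<close>, and \<open>M = \<psi>(N)\<close>.  The
  theorem has an algebraic half and a metric half.

  The algebraic half shows that the twisted class of \<open>g\<^sub>0\<close> is a finite union of cosets of \<open>M\<close>.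
  Write a twisting element as \<open>z = n t\<close> with \<open>n \<in> N\<close> and \<open>t\<close> in a finite set of representatives
  of \<open>G/N\<close>.  Then \<open>z g\<^sub>0 \<phi>(z)\<^sup>-\<^sup>1 = n a \<phi>(n)\<^sup>-\<^sup>1\<close> with \<open>a = t g\<^sub>0 \<phi>(t)\<^sup>-\<^sup>1\<close>, and this is
  \<open>(n - a \<phi>(n) a\<^sup>-\<^sup>1) a\<close> with the bracket written additively.  As \<open>G/N\<close> is abelian and \<open>\<phi>\<close>
  acts trivially on it, \<open>a\<close> is congruent to \<open>g\<^sub>0\<close> modulo \<open>N\<close>; as \<open>N\<close> is abelian, \<open>a\<close> and
  \<open>g\<^sub>0\<close> act on \<open>N\<close> by the same conjugation, whatever \<open>t\<close> is.  So the element is \<open>\<psi>(n) a\<close> with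
  one and the same \<open>\<psi>\<close> for all \<open>t\<close> (\<open>twisted_class_eq_union_of_cosets\<close>).

  The metric half shows that a finite union of cosets of \<open>M \<cong> \<int>\<^sup>k\<close> has growth \<open>r\<^sup>k\<close> in \<open>G\<close>
  (\<open>growth_of_union_of_cosets\<close>).  Passing to a coset changes lengths by a bounded amount only,
  so it suffices to count elements of \<open>M\<close>.  A coordinate vector with entries of size at most
  \<open>m\<close> gives an element of length at most \<open>L m\<close>, which yields the lower bound.  The upper bound
  says that coordinates on \<open>M\<close> are Lipschitz for the word length of \<open>G\<close>: each of them extends
  to an additive map \<open>N \<rightarrow> \<real>\<close> because \<open>\<real>\<close> is divisible (\<open>additive_on_extend\<close>), and Schreier's
  rewriting writes an element of \<open>N\<close> of length \<open>l\<close> as a product of \<open>l\<close> factors from a finite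
  subset of \<open>N\<close> (\<open>schreier_generators\<close>), so that an additive map on \<open>N\<close> grows at most
  linearly.

  That \<open>M\<close> is free of some finite rank is the structure theorem for finitely generated
  torsion-free abelian groups (\<open>fin_gen_torsion_free_imp_free\<close>).\<close>

section \<open>Finitely generated torsion-free abelian groups are free\<close>

abbreviation coeff_norm :: "'i set \<Rightarrow> ('i \<Rightarrow>\<^sub>0 int) \<Rightarrow> nat"
  where "coeff_norm I c \<equiv> \<Sum>i\<in>I. nat \<bar>poly_mapping.lookup c i\<bar>"

text \<open>The step of Euclid's algorithm behind the structure theorem.  A generating family indexed by
  \<open>I\<close> is a surjection \<open>h\<close> from the free abelian group on \<open>I\<close>, and a relation is an element
  \<open>c\<close> of its kernel.  If \<open>c\<close> involves two generators, precomposing \<open>h\<close> with an elementary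
  automorphism replaces \<open>c\<close> by a relation with smaller coefficients.  If \<open>c\<close> is a multiple of
  a single generator, that generator is trivial by torsion-freeness and can be dropped.\<close>
lemma (in comm_group) relation_imp_fewer_generators:
  fixes h :: "('i \<Rightarrow>\<^sub>0 int) \<Rightarrow> 'a"
  assumes tf: "torsion_free G" and I: "finite I"
    and h: "h \<in> hom (free_Abelian_group I) G" "carrier G \<subseteq> h ` carrier (free_Abelian_group I)"
    and c: "Poly_Mapping.keys c \<subseteq> I" "c \<noteq> 0" "h c = \<one>"
  shows "\<exists>J h'. J \<subset> I \<and> h' \<in> hom (free_Abelian_group J) G \<and> carrier G \<subseteq> h' ` carrier (free_Abelian_group J)"
  using h c
proof (induction "coeff_norm I c" arbitrary: c h rule: less_induct)
  case less
  let ?F = "free_Abelian_group I"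
  interpret h: group_hom ?F G h
    using less.prems(1) is_group by (simp add: group_hom_def group_hom_axioms_def)
  obtain i where i: "poly_mapping.lookup c i \<noteq> 0"
    using less.prems(4) by (metis lookup_zero poly_mapping_eqI)
  then have iI: "i \<in> I"
    using less.prems(3) by (meson in_keys_iff subsetD)
  show ?case
  proof (cases "\<exists>j. j \<noteq> i \<and> poly_mapping.lookup c j \<noteq> 0")
    case True
    then obtain a b where ab: "a \<noteq> b" "poly_mapping.lookup c a \<noteq> 0" "poly_mapping.lookup c b \<noteq> 0" "\<bar>poly_mapping.lookup c b\<bar> \<le> \<bar>poly_mapping.lookup c a\<bar>"
      using i by (metis linear)
    have abI: "a \<in> I" "b \<in> I"
      using ab less.prems(3) by (meson in_keys_iff subsetD)+
    obtain s :: int where s: "\<bar>poly_mapping.lookup c a - s * poly_mapping.lookup c b\<bar> < \<bar>poly_mapping.lookup c a\<bar>"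
    proof (cases "poly_mapping.lookup c a > 0 \<longleftrightarrow> poly_mapping.lookup c b > 0")
      case True
      then have "\<bar>poly_mapping.lookup c a - 1 * poly_mapping.lookup c b\<bar> < \<bar>poly_mapping.lookup c a\<bar>" using ab by auto
      then show ?thesis by (rule that)
    next
      case False
      then have "\<bar>poly_mapping.lookup c a - (-1) * poly_mapping.lookup c b\<bar> < \<bar>poly_mapping.lookup c a\<bar>" using ab by auto
      then show ?thesis by (rule that)
    qed
    \<comment> \<open>The elementary automorphism that adds \<open>u\<close> times the \<open>b\<close>-coefficient to the
      \<open>a\<close>-coefficient; its inverse is the one for \<open>- u\<close>.\<close>
    define \<theta> where "\<theta> = (\<lambda>u d. d + frag_cmul (u * poly_mapping.lookup d b) (frag_of a) :: 'i \<Rightarrow>\<^sub>0 int)"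
    have look: "poly_mapping.lookup (\<theta> u d) j = poly_mapping.lookup d j + (if j = a then u * poly_mapping.lookup d b else 0)" for u d j
      by (simp add: \<theta>_def lookup_add lookup_single when_def)
    have inv: "\<theta> u (\<theta> (-u) d) = d" for u d
      by (rule poly_mapping_eqI) (use ab(1) in \<open>auto simp: look\<close>)
    have keys: "Poly_Mapping.keys (\<theta> u d) \<subseteq> I" if "Poly_Mapping.keys d \<subseteq> I" for u d
      using that abI by (auto simp: in_keys_iff look subset_iff split: if_splits)
    have \<theta>_hom: "\<theta> u \<in> hom ?F ?F" for u
      by (rule homI) (auto simp: keys[THEN subsetD] look lookup_add algebra_simps intro!: poly_mapping_eqI)
    have "\<exists>J h'. J \<subset> I \<and> h' \<in> hom (free_Abelian_group J) G \<and> carrier G \<subseteq> h' ` carrier (free_Abelian_group J)"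
    proof (rule less.hyps)
      show "coeff_norm I (\<theta> (-s) c) < coeff_norm I c"
        using s abI(1) by (intro sum_strict_mono_ex1) (auto simp: look I)
      show "h \<circ> \<theta> s \<in> hom ?F G"
        using \<theta>_hom less.prems(1) by (rule Group.hom_compose)
      show "carrier G \<subseteq> (h \<circ> \<theta> s) ` carrier ?F"
      proof
        fix x assume "x \<in> carrier G"
        then obtain d where "Poly_Mapping.keys d \<subseteq> I" "x = h d" using less.prems(2) by auto
        then show "x \<in> (h \<circ> \<theta> s) ` carrier ?F"
          using keys[of d "-s"] inv[of s d] by (intro image_eqI[of _ _ "\<theta> (-s) d"]) auto
      qed
      show "Poly_Mapping.keys (\<theta> (-s) c) \<subseteq> I" by (rule keys[OF less.prems(3)])
      show "\<theta> (-s) c \<noteq> 0" using ab by (metis look lookup_zero add.right_neutral)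
      show "(h \<circ> \<theta> s) (\<theta> (-s) c) = \<one>" using less.prems(5) inv by simp
    qed
    then show ?thesis .
  next
    case False
    have one_i: "h (frag_of i) = \<one>"
    proof -
      define m where "m = poly_mapping.lookup c i"
      have ceq: "c = frag_cmul m (frag_of i)"
        by (rule poly_mapping_eqI) (use False in \<open>auto simp: m_def lookup_single when_def\<close>)
      let ?x = "h (frag_of i)"
      have xG: "?x \<in> carrier G" using iI by (auto intro: h.hom_closed)
      have "?x [^] m = \<one>"
        using h.hom_int_pow[of "frag_of i" m] iI less.prems(5) ceq by simp
      then have "?x [^] (nat \<bar>m\<bar>) = \<one>"
      proof (cases "m < 0")
        case True
        then have "nat \<bar>m\<bar> = nat (- m)" by simp
        then show ?thesis
          using \<open>?x [^] m = \<one>\<close> True xG by (metis int_pow_def2 inv_eq_1_iff nat_pow_closed)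
      next
        case False
        then have "nat \<bar>m\<bar> = nat m" "0 \<le> m" by simp_all
        then show ?thesis
          using \<open>?x [^] m = \<one>\<close> pow_nat[of m G ?x] by metis
      qed
      moreover have "nat \<bar>m\<bar> > 0" using i by (simp add: m_def)
      ultimately show ?thesis
        using tf xG unfolding torsion_free_def by blast
    qed
    \<comment> \<open>Deleting the \<open>i\<close>-coefficient does not change the value of \<open>h\<close>.\<close>
    let ?J = "I - {i}"
    have "h \<in> hom (free_Abelian_group ?J) G"
    proof (rule homI)
      fix x y assume "x \<in> carrier (free_Abelian_group ?J)" "y \<in> carrier (free_Abelian_group ?J)"
      then show "h (x \<otimes>\<^bsub>free_Abelian_group ?J\<^esub> y) = h x \<otimes> h y"
        using h.hom_mult[of x y] by auto
    qed (auto intro!: h.hom_closed)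
    moreover have "carrier G \<subseteq> h ` carrier (free_Abelian_group ?J)"
    proof
      fix x assume "x \<in> carrier G"
      then obtain d where d: "Poly_Mapping.keys d \<subseteq> I" "x = h d" using less.prems(2) by auto
      define e where "e = d - frag_cmul (poly_mapping.lookup d i) (frag_of i)"
      have look: "poly_mapping.lookup e j = (if j = i then 0 else poly_mapping.lookup d j)" for j
        by (auto simp: e_def lookup_minus lookup_single when_def)
      have e: "Poly_Mapping.keys e \<subseteq> ?J"
        using d by (auto simp: in_keys_iff look subset_iff split: if_splits)
      have k: "Poly_Mapping.keys (frag_cmul (poly_mapping.lookup d i) (frag_of i)) \<subseteq> I"
        using iI by (auto simp: in_keys_iff lookup_single when_def split: if_splits)
      have "h (e + frag_cmul (poly_mapping.lookup d i) (frag_of i)) = h e \<otimes> h (frag_cmul (poly_mapping.lookup d i) (frag_of i))"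
        using h.hom_mult[of e "frag_cmul (poly_mapping.lookup d i) (frag_of i)"] e k by auto
      also have "h (frag_cmul (poly_mapping.lookup d i) (frag_of i)) = \<one>"
        using h.hom_int_pow[of "frag_of i" "poly_mapping.lookup d i"] iI one_i by simp
      finally have "h d = h e"
        using e by (auto simp: e_def intro!: h.hom_closed r_one)
      then show "x \<in> h ` carrier (free_Abelian_group ?J)"
        using d e by auto
    qed
    ultimately show ?thesis using iI by blast
  qed
qed

text \<open>Among the surjections from free abelian groups on finite subsets, one whose index set cannot
  be shrunk is injective, since any relation would allow shrinking it.\<close>
lemma (in comm_group) fin_gen_torsion_free_imp_free:
  assumes tf: "torsion_free G" and B: "finite B" "generate G B = carrier G"
  shows "\<exists>n. G \<cong> free_Abelian_group {..<n::nat}"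
proof -
  have step: "\<exists>n. G \<cong> free_Abelian_group {..<n::nat}"
    if "finite I" "h \<in> hom (free_Abelian_group I) G" "carrier G \<subseteq> h ` carrier (free_Abelian_group I)"
    for I :: "'a set" and h
    using that
  proof (induction I arbitrary: h rule: finite_psubset_induct)
    case (psubset I)
    interpret h: group_hom "free_Abelian_group I" G h
      using psubset.prems(1) is_group by (simp add: group_hom_def group_hom_axioms_def)
    show ?case
    proof (cases "\<exists>c. Poly_Mapping.keys c \<subseteq> I \<and> c \<noteq> 0 \<and> h c = \<one>")
      case True
      then show ?thesis
        using relation_imp_fewer_generators[OF tf psubset.hyps psubset.prems] psubset.IH by blast
    next
      case False
      then have "kernel (free_Abelian_group I) G h = {\<one>\<^bsub>free_Abelian_group I\<^esub>}"
        using h.hom_one by (auto simp: kernel_def)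
      then have "h \<in> iso (free_Abelian_group I) G"
        using psubset.prems h.inj_iff_trivial_ker h.hom_closed
        by (auto simp: iso_def bij_betw_def)
      then have 1: "free_Abelian_group I \<cong> G" by (rule is_isoI)
      have "I \<approx> {..<card I}"
        using psubset.hyps by (simp add: eqpoll_iff_card)
      then have 2: "free_Abelian_group I \<cong> free_Abelian_group {..<card I}"
        by (simp add: isomorphic_free_Abelian_groups)
      show ?thesis
        using group.iso_sym[OF group_free_Abelian_group 1] 2 iso_trans by blast
    qed
  qed
  have BG: "B \<subseteq> carrier G" using B(2) by (metis generate.incl subsetI)
  then have "id ` B \<subseteq> carrier G" by simp
  then obtain h where h: "h \<in> hom (free_Abelian_group B) G" "\<And>x. x \<in> B \<Longrightarrow> h (frag_of x) = id x"
    by (rule free_Abelian_group_universal) blast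
  interpret h: group_hom "free_Abelian_group B" G h
    using h is_group by (simp add: group_hom_def group_hom_axioms_def)
  have "generate G B \<subseteq> h ` carrier (free_Abelian_group B)"
  proof (rule generate_subgroup_incl)
    show "B \<subseteq> h ` carrier (free_Abelian_group B)"
      using h(2) by (force intro: image_eqI[of _ _ "frag_of _"])
    show "subgroup (h ` carrier (free_Abelian_group B)) G"
      by (rule h.img_is_subgroup)
  qed
  then show ?thesis using step[OF B(1) h(1)] B(2) by simp
qed

lemma free_rank_eqI:
  assumes "group A" "A \<cong> free_Abelian_group {..<n}"
  shows "free_rank A = n"
  unfolding free_rank_def
proof (rule the_equality)
  fix m :: nat assume "A \<cong> free_Abelian_group {..<m}"
  then have "free_Abelian_group {..<m} \<cong> free_Abelian_group {..<n}"
    using assms by (meson group.iso_sym iso_trans)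
  then show "m = n"
    by (simp add: isomorphic_free_Abelian_groups eqpoll_iff_card)
qed (rule assms)

section \<open>Extending additive maps to the reals\<close>

definition additive_on :: "('a, 'b) monoid_scheme \<Rightarrow> 'a set \<Rightarrow> ('a \<Rightarrow> real) \<Rightarrow> bool" where
  "additive_on G H f \<longleftrightarrow> (\<forall>x\<in>H. \<forall>y\<in>H. f (x \<otimes>\<^bsub>G\<^esub> y) = f x + f y)"

lemma additive_onD:
  "additive_on G H f \<Longrightarrow> x \<in> H \<Longrightarrow> y \<in> H \<Longrightarrow> f (x \<otimes>\<^bsub>G\<^esub> y) = f x + f y"
  by (simp add: additive_on_def)

context group
begin

lemma additive_on_one:
  assumes "subgroup H G" "additive_on G H f"
  shows "f \<one> = 0"
  using additive_onD[OF assms(2), of \<one> \<one>] subgroup.one_closed[OF assms(1)] by simp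

lemma additive_on_inv:
  assumes "subgroup H G" "additive_on G H f" "x \<in> H"
  shows "f (inv x) = - f x"
  using additive_onD[OF assms(2), of x "inv x"] additive_on_one[OF assms(1,2)] assms(1,3)
  by (simp add: subgroup.m_inv_closed subgroup.mem_carrier)

lemma additive_on_int_pow:
  assumes H: "subgroup H G" and f: "additive_on G H f" and x: "x \<in> H"
  shows "f (x [^] (i::int)) = of_int i * f x"
proof -
  have mem: "x [^] n \<in> H" for n :: nat
    by (induction n) (auto simp: subgroup.one_closed[OF H] subgroup.m_closed[OF H] x)
  have nat: "f (x [^] n) = real n * f x" for n :: nat
    by (induction n) (auto simp: additive_on_one[OF H f] additive_onD[OF f] mem x algebra_simps)
  show ?thesis
  proof (cases i rule: int_cases2)
    case (nonneg n)
    then show ?thesis using nat[of n] by (simp add: int_pow_int)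
  next
    case (nonpos n)
    then show ?thesis
      using nat[of n] additive_on_inv[OF H f mem[of n]] subgroup.mem_carrier[OF H x]
      by (simp add: int_pow_neg_int)
  qed
qed

end

context comm_group
begin

text \<open>The new value at \<open>b\<close> is forced if a power of \<open>b\<close> with nonzero exponent lies in \<open>H\<close>, in which case it
  is obtained by division, and is free otherwise.\<close>
lemma additive_on_extend_by_one:
  assumes H: "subgroup H G" and f: "additive_on G H f" and b: "b \<in> carrier G"
  shows "\<exists>K F. subgroup K G \<and> H \<subseteq> K \<and> b \<in> K \<and> additive_on G K F \<and> (\<forall>x\<in>H. F x = f x)"
proof -
  interpret H: subgroup H G by (rule H)
  \<comment> \<open>\<open>c\<close> is the value of the extension at \<open>b\<close>.\<close>
  obtain c where c: "\<And>i::int. b [^] i \<in> H \<Longrightarrow> f (b [^] i) = of_int i * c"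
  proof (cases "\<exists>m::int. m \<noteq> 0 \<and> b [^] m \<in> H")
    case True
    then obtain m :: int where m: "m \<noteq> 0" "b [^] m \<in> H" by blast
    have "f (b [^] i) = of_int i * (f (b [^] m) / of_int m)" if i: "b [^] i \<in> H" for i :: int
    proof -
      have "of_int m * f (b [^] i) = f ((b [^] i) [^] m)"
        by (simp add: additive_on_int_pow[OF H f i])
      also have "(b [^] i) [^] m = (b [^] m) [^] i"
        by (simp add: int_pow_pow b mult.commute)
      also have "f \<dots> = of_int i * f (b [^] m)"
        by (rule additive_on_int_pow[OF H f m(2)])
      finally show ?thesis using m by (simp add: field_simps)
    qed
    then show ?thesis by (rule that)
  next
    case False
    then show ?thesis using that[of 0] additive_on_one[OF H f] by (metis int_pow_0 mult_zero_left of_int_0)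
  qed
  define K where "K = {x \<otimes> b [^] i | x i::int. x \<in> H}"
  \<comment> \<open>\<open>P y v\<close> says that some way of writing \<open>y\<close> prescribes the value \<open>v\<close>; \<open>uniq\<close> below is
    independence of the way of writing \<open>y\<close>.\<close>
  define P where "P = (\<lambda>y v. \<exists>x i::int. x \<in> H \<and> y = x \<otimes> b [^] i \<and> v = f x + of_int i * c)"
  define F where "F = (\<lambda>y. THE v. P y v)"
  have uniq: "v = w" if "P y v" "P y w" for y v w
  proof -
    obtain x and i :: int where x: "x \<in> H" "y = x \<otimes> b [^] i" "v = f x + of_int i * c"
      using \<open>P y v\<close> unfolding P_def by blast
    obtain x' and j :: int where x': "x' \<in> H" "y = x' \<otimes> b [^] j" "w = f x' + of_int j * c"
      using \<open>P y w\<close> unfolding P_def by blast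
    note * = x x'
    have "x \<otimes> b [^] (i - j) = (x \<otimes> b [^] i) \<otimes> inv (b [^] j)"
      using x(1) b by (simp add: int_pow_diff m_assoc)
    also have "\<dots> = (x' \<otimes> b [^] j) \<otimes> inv (b [^] j)"
      using x(2) x'(2) by metis
    also have "\<dots> = x'"
      using x'(1) b by (simp add: m_assoc)
    finally have eq: "b [^] (i - j) = inv x \<otimes> x'"
      using x(1) b by (metis H.mem_carrier int_pow_closed inv_closed l_inv l_one m_assoc)
    then have "f (inv x \<otimes> x') = of_int (i - j) * c"
      using c[of "i - j"] * by simp
    moreover have "f (inv x \<otimes> x') = f x' - f x"
      using * by (simp add: additive_onD[OF f] additive_on_inv[OF H f])
    ultimately show ?thesis using * by (simp add: algebra_simps)
  qed
  have F: "F (x \<otimes> b [^] i) = f x + of_int i * c" if "x \<in> H" for x and i :: int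
  proof -
    have "P (x \<otimes> b [^] i) (f x + of_int i * c)" using that unfolding P_def by blast
    then show ?thesis unfolding F_def using uniq by (intro the_equality)
  qed
  have split: "(x \<otimes> b [^] i) \<otimes> (y \<otimes> b [^] j) = (x \<otimes> y) \<otimes> b [^] (i + j)"
    if "x \<in> H" "y \<in> H" for x y and i j :: int
    using that b by (simp add: int_pow_mult m_ac)
  have "subgroup K G"
  proof (rule subgroupI)
    show "K \<subseteq> carrier G" using b by (auto simp: K_def)
    show "K \<noteq> {}" using H.one_closed unfolding K_def by blast
    show "inv a \<in> K" if "a \<in> K" for a
    proof -
      obtain x and i :: int where "x \<in> H" "a = x \<otimes> b [^] i" using \<open>a \<in> K\<close> by (auto simp: K_def)
      then have "inv a = inv x \<otimes> b [^] (- i)" using b by (simp add: inv_mult int_pow_neg)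
      then show ?thesis using \<open>x \<in> H\<close> unfolding K_def by blast
    qed
    show "a \<otimes> a' \<in> K" if "a \<in> K" "a' \<in> K" for a a'
    proof -
      obtain x and i :: int where "x \<in> H" "a = x \<otimes> b [^] i" using \<open>a \<in> K\<close> by (auto simp: K_def)
      moreover obtain y and j :: int where "y \<in> H" "a' = y \<otimes> b [^] j" using \<open>a' \<in> K\<close> by (auto simp: K_def)
      ultimately show ?thesis unfolding K_def using split[of x y i j] by blast
    qed
  qed
  moreover have "H \<subseteq> K"
  proof
    fix x assume "x \<in> H"
    then have "x = x \<otimes> b [^] (0::int)" by simp
    then show "x \<in> K" using \<open>x \<in> H\<close> unfolding K_def by blast
  qed
  moreover have "b \<in> K"
  proof -
    have "b = \<one> \<otimes> b [^] (1::int)" using b by simp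
    then show ?thesis unfolding K_def using H.one_closed by blast
  qed
  moreover have "additive_on G K F"
    unfolding additive_on_def K_def by (auto simp: split F additive_onD[OF f] algebra_simps)
  moreover have "\<forall>x\<in>H. F x = f x"
    using F[of _ 0] by simp
  ultimately show ?thesis by blast
qed

lemma additive_on_extend:
  assumes H: "subgroup H G" and f: "additive_on G H f" and B: "finite B" "generate G B = carrier G"
  shows "\<exists>F. additive_on G (carrier G) F \<and> (\<forall>x\<in>H. F x = f x)"
proof -
  have "B \<subseteq> carrier G" using B(2) by (metis generate.incl subsetI)
  with B(1) have "\<exists>K F. subgroup K G \<and> H \<subseteq> K \<and> B \<subseteq> K \<and> additive_on G K F \<and> (\<forall>x\<in>H. F x = f x)"
  proof (induction rule: finite_induct)
    case empty
    then show ?case using H f by blast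
  next
    case (insert b B)
    then obtain K F where K: "subgroup K G" "H \<subseteq> K" "B \<subseteq> K" "additive_on G K F"
      and Ff: "\<forall>x\<in>H. F x = f x"
      by auto
    obtain K' F' where K': "subgroup K' G" "K \<subseteq> K'" "b \<in> K'" "additive_on G K' F'" "\<forall>x\<in>K. F' x = F x"
      using additive_on_extend_by_one[OF K(1) K(4), of b] insert.prems by auto
    have "\<forall>x\<in>H. F' x = f x" using K'(5) Ff K(2) by auto
    then show ?case using K' K(2,3) by (intro exI[of _ K'] exI[of _ F']) auto
  qed
  then obtain K F where K: "subgroup K G" "B \<subseteq> K" "additive_on G K F" "\<forall>x\<in>H. F x = f x"
    by blast
  then have "carrier G \<subseteq> K" using generate_subgroup_incl B by metis
  then have "K = carrier G" using K(1) subgroup.subset by blast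
  then show ?thesis using K by blast
qed

end

section \<open>Word length and subgroups of finite index\<close>

context group
begin

abbreviation word_product :: "'a list \<Rightarrow> 'a" where
  "word_product ws \<equiv> foldr (\<otimes>) ws \<one>"

lemma word_product_closed: "set ws \<subseteq> carrier G \<Longrightarrow> word_product ws \<in> carrier G"
  by (induction ws) auto

lemma word_product_append:
  "set us \<subseteq> carrier G \<Longrightarrow> set vs \<subseteq> carrier G \<Longrightarrow>
     word_product (us @ vs) = word_product us \<otimes> word_product vs"
  by (induction us) (auto simp: m_assoc word_product_closed)

lemma word_product_in_generate:
  "set ws \<subseteq> B \<Longrightarrow> word_product ws \<in> generate G B"
  by (induction ws) (auto intro: generate.intros)

text \<open>Schreier's rewriting, in a form that keeps track of lengths.  Reading a word letter by letter,
  the coset representative of the prefix is updated at each letter \<open>s\<close>, and the correction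
  \<open>t s \<rho>(t s)\<^sup>-\<^sup>1\<close> lies in \<open>H\<close>.  There are finitely many pairs \<open>(t, s)\<close>, and each letter
  contributes exactly one correction, so the length is preserved.\<close>
lemma schreier_generators:
  assumes H: "subgroup H G" and fin: "finite_index G H" and A: "finite A" "A \<subseteq> carrier G"
  shows "\<exists>B. finite B \<and> B \<subseteq> H \<and>
    (\<forall>ws. set ws \<subseteq> A \<and> word_product ws \<in> H \<longrightarrow>
      (\<exists>us. set us \<subseteq> B \<and> length us = length ws \<and> word_product us = word_product ws))"
proof -
  interpret H: subgroup H G by (rule H)
  \<comment> \<open>The subgroup itself is represented by \<open>\<one>\<close>, so that a word with value in \<open>H\<close> starts and
    ends at the representative \<open>\<one>\<close> and its corrections multiply to exactly its value.\<close>
  define R where "R = (\<lambda>C. if C = H then \<one> else SOME t. t \<in> C)"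
  define \<rho> where "\<rho> = (\<lambda>g. R (H #> g))"
  define B where "B = (\<lambda>(t, s). t \<otimes> s \<otimes> inv (\<rho> (t \<otimes> s))) ` (\<rho> ` carrier G \<times> A)"
  have \<rho>_mem: "\<rho> g \<in> H #> g" if g: "g \<in> carrier G" for g
  proof (cases "H #> g = H")
    case True
    then show ?thesis by (simp add: \<rho>_def R_def)
  next
    case False
    then show ?thesis
      using someI[of "\<lambda>t. t \<in> H #> g" g] rcos_self[OF g H] by (simp add: \<rho>_def R_def)
  qed
  have \<rho>_closed: "\<rho> g \<in> carrier G" if "g \<in> carrier G" for g
    using \<rho>_mem[OF that] r_coset_subset_G[OF H.subset that] by blast
  have coset: "H #> \<rho> g = H #> g" if "g \<in> carrier G" for g
    using repr_independence[OF \<rho>_mem[OF that] that H] by simp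
  have \<rho>_idem: "\<rho> (\<rho> g) = \<rho> g" if "g \<in> carrier G" for g
    using coset[OF that] by (simp add: \<rho>_def)
  have \<rho>_mult: "\<rho> (\<rho> g \<otimes> x) = \<rho> (g \<otimes> x)" if "g \<in> carrier G" "x \<in> carrier G" for g x
    using coset_mult_assoc[OF H.subset \<rho>_closed[OF that(1)] that(2)]
      coset_mult_assoc[OF H.subset that] coset[OF that(1)]
    by (simp add: \<rho>_def)
  have "H #> \<one> = H" by (rule coset_mult_one[OF H.subset])
  then have \<rho>_H: "\<rho> h = \<one>" if "h \<in> H" for h
    using coset_join2[OF _ H that] that by (simp add: \<rho>_def R_def)
  have "\<rho> ` carrier G \<subseteq> R ` (rcosets H)"
    by (auto simp: \<rho>_def RCOSETS_def)
  then have "finite (\<rho> ` carrier G)"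
    using fin finite_subset unfolding finite_index_def by blast
  then have "finite B" using A by (simp add: B_def)
  moreover have "B \<subseteq> H"
  proof -
    have "g \<otimes> inv (\<rho> g) \<in> H" if "g \<in> carrier G" for g
      using H.rcos_module_imp[OF is_group \<rho>_closed[OF that], of g] coset[OF that] rcos_self[OF that H]
      by simp
    then show ?thesis using A \<rho>_closed by (auto simp: B_def)
  qed
  moreover have "\<exists>us. set us \<subseteq> B \<and> length us = length ws \<and> word_product us = word_product ws"
    if ws: "set ws \<subseteq> A" "word_product ws \<in> H" for ws
  proof -
    have gen: "\<exists>us. set us \<subseteq> B \<and> length us = length ws \<and>
        word_product us = t \<otimes> word_product ws \<otimes> inv (\<rho> (t \<otimes> word_product ws))"
      if "set ws \<subseteq> A" "t \<in> \<rho> ` carrier G" for ws t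
      using that
    proof (induction ws arbitrary: t)
      case Nil
      then show ?case using \<rho>_closed \<rho>_idem by auto
    next
      case (Cons s ws)
      then have tc: "t \<in> carrier G" and sA: "s \<in> A" and s: "s \<in> carrier G" and ws: "set ws \<subseteq> carrier G"
        using A \<rho>_closed by auto
      define t' where "t' = \<rho> (t \<otimes> s)"
      define p where "p = word_product ws"
      have p: "p \<in> carrier G" using ws by (simp add: p_def word_product_closed)
      have t': "t' \<in> \<rho> ` carrier G" "t' \<in> carrier G" using tc s \<rho>_closed by (auto simp: t'_def)
      obtain us where us: "set us \<subseteq> B" "length us = length ws"
        "word_product us = t' \<otimes> p \<otimes> inv (\<rho> (t' \<otimes> p))"
        using Cons.IH[OF _ t'(1)] Cons.prems by (auto simp: p_def)
      have "\<rho> (t' \<otimes> p) = \<rho> (t \<otimes> (s \<otimes> p))"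
        using \<rho>_mult[of "t \<otimes> s" p] tc s p by (simp add: t'_def m_assoc)
      moreover have "(t \<otimes> s \<otimes> inv t') \<otimes> (t' \<otimes> p \<otimes> inv x) = t \<otimes> (s \<otimes> p) \<otimes> inv x"
        if "x \<in> carrier G" for x
      proof -
        have "(t \<otimes> s \<otimes> inv t') \<otimes> (t' \<otimes> p \<otimes> inv x) = t \<otimes> s \<otimes> (inv t' \<otimes> t') \<otimes> p \<otimes> inv x"
          using that tc s p t' by (simp only: m_assoc m_closed inv_closed)
        then show ?thesis using that tc s p t' by (simp add: m_assoc)
      qed
      moreover have "\<rho> (t' \<otimes> p) \<in> carrier G" using t' p \<rho>_closed by auto
      ultimately have "word_product ((t \<otimes> s \<otimes> inv t') # us) =
          t \<otimes> word_product (s # ws) \<otimes> inv (\<rho> (t \<otimes> word_product (s # ws)))"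
        using us(3) by (simp add: p_def)
      moreover have "t \<otimes> s \<otimes> inv t' \<in> B"
        using Cons.prems(2) sA by (auto simp: B_def t'_def)
      ultimately show ?case
        using us by (intro exI[of _ "(t \<otimes> s \<otimes> inv t') # us"]) auto
    qed
    have "\<one> \<in> \<rho> ` carrier G" using \<rho>_H[of \<one>] by (metis H.one_closed imageI one_closed)
    moreover have "set ws \<subseteq> carrier G" using ws A by auto
    ultimately show ?thesis
      using gen[OF ws(1), of \<one>] \<rho>_H[OF ws(2)] word_product_closed by auto
  qed
  ultimately show ?thesis by blast
qed

end

text \<open>Fixing the generating set makes word length a function of the group element alone.\<close>
locale finitely_generated_group = group G for G (structure) +
  fixes S
  assumes generating: "finite_generating_set G S"
begin

abbreviation letters :: "'a set" where "letters \<equiv> S \<union> set_inv S"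

abbreviation len :: "'a \<Rightarrow> nat" where "len \<equiv> word_length G S"

lemma finite_letters: "finite letters" and letters_closed: "letters \<subseteq> carrier G"
  and generate_S: "generate G S = carrier G"
  using generating by (auto simp: finite_generating_set_def SET_INV_def)

lemma ex_word: "g \<in> carrier G \<Longrightarrow> \<exists>ws. set ws \<subseteq> letters \<and> word_product ws = g"
proof -
  assume "g \<in> carrier G"
  then have "g \<in> generate G S" by (simp add: generate_S)
  then show ?thesis
  proof induction
    case one
    show ?case by (rule exI[of _ "[]"]) simp
  next
    case (incl h)
    then show ?case using letters_closed by (intro exI[of _ "[h]"]) auto
  next
    case (inv h)
    then have "inv h \<in> letters" by (auto simp: SET_INV_def)
    then show ?case using letters_closed by (intro exI[of _ "[inv h]"]) auto
  next
    case (eng h1 h2)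
    then obtain us vs where "set us \<subseteq> letters" "word_product us = h1" "set vs \<subseteq> letters" "word_product vs = h2"
      by blast
    moreover from this have "word_product (us @ vs) = word_product us \<otimes> word_product vs"
      using letters_closed by (intro word_product_append) auto
    ultimately show ?case
      by (intro exI[of _ "us @ vs"]) (auto simp del: foldr_append)
  qed
qed

lemma len_word:
  assumes "g \<in> carrier G"
  obtains ws where "length ws = len g" "set ws \<subseteq> letters" "word_product ws = g"
proof -
  have "\<exists>k ws. length ws = k \<and> set ws \<subseteq> letters \<and> word_product ws = g"
    using ex_word[OF assms] by blast
  then have "\<exists>ws. length ws = len g \<and> set ws \<subseteq> letters \<and> word_product ws = g"
    unfolding word_length_def by (rule LeastI_ex)
  then show ?thesis using that by blast
qed

lemma len_le: "set ws \<subseteq> letters \<Longrightarrow> word_product ws = g \<Longrightarrow> len g \<le> length ws"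
  unfolding word_length_def by (rule Least_le) blast

lemma len_one [simp]: "len \<one> = 0"
  using len_le[of "[]" \<one>] by simp

lemma len_mult:
  assumes "g \<in> carrier G" "h \<in> carrier G"
  shows "len (g \<otimes> h) \<le> len g + len h"
proof -
  obtain us where us: "length us = len g" "set us \<subseteq> letters" "word_product us = g"
    using len_word[OF assms(1)] .
  obtain vs where vs: "length vs = len h" "set vs \<subseteq> letters" "word_product vs = h"
    using len_word[OF assms(2)] .
  have "word_product (us @ vs) = g \<otimes> h"
    using us vs letters_closed by (subst word_product_append) auto
  then show ?thesis
    using len_le[of "us @ vs"] us vs by auto
qed

text \<open>Both \<open>x\<close> and \<open>inv x\<close> enter the constant in order to cover powers of either sign without
  comparing the lengths of an element and its inverse.\<close>
lemma len_int_pow: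
  assumes "x \<in> carrier G"
  shows "len (x [^] (i::int)) \<le> nat \<bar>i\<bar> * (len x + len (inv x))"
proof -
  have pow: "len (y [^] n) \<le> n * len y" if y: "y \<in> carrier G" for y and n :: nat
  proof (induction n)
    case (Suc n)
    then show ?case using len_mult[of "y [^] n" y] y by auto
  qed simp
  show ?thesis
  proof (cases "i < 0")
    case True
    then have "x [^] i = (inv x) [^] (nat \<bar>i\<bar>)"
      using assms int_pow_def2[of G x i] nat_pow_inv[of x "nat (- i)"] by (metis abs_of_neg)
    then show ?thesis
      using pow[of "inv x" "nat \<bar>i\<bar>"] assms by (simp add: algebra_simps)
  next
    case False
    then have "x [^] i = x [^] (nat \<bar>i\<bar>)"
      using int_pow_def2[of G x i] by simp
    then show ?thesis
      using pow[of x "nat \<bar>i\<bar>"] assms by (simp add: algebra_simps)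
  qed
qed

lemma finite_ball: "finite {g \<in> carrier G. real (len g) \<le> r}"
proof (rule finite_subset)
  let ?W = "{ws. set ws \<subseteq> letters \<and> length ws \<le> nat \<lfloor>r\<rfloor>}"
  show "{g \<in> carrier G. real (len g) \<le> r} \<subseteq> word_product ` ?W"
  proof safe
    fix g assume g: "g \<in> carrier G" "real (len g) \<le> r"
    obtain ws where "length ws = len g" "set ws \<subseteq> letters" "word_product ws = g"
      using len_word[OF g(1)] .
    moreover have "len g \<le> nat \<lfloor>r\<rfloor>" using g(2) by (simp add: le_nat_floor)
    ultimately show "g \<in> word_product ` ?W" by (intro image_eqI[of _ _ ws]) auto
  qed
  show "finite (word_product ` ?W)"
    using finite_lists_length_le[OF finite_letters] by (rule finite_imageI)
qed

lemma finite_index_word_generators: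
  assumes "subgroup H G" "finite_index G H"
  shows "\<exists>B. finite B \<and> B \<subseteq> H \<and>
    (\<forall>h\<in>H. \<exists>us. set us \<subseteq> B \<and> length us = len h \<and> word_product us = h)"
proof -
  obtain B where B: "finite B" "B \<subseteq> H" "\<And>ws. set ws \<subseteq> letters \<Longrightarrow> word_product ws \<in> H \<Longrightarrow>
      \<exists>us. set us \<subseteq> B \<and> length us = length ws \<and> word_product us = word_product ws"
    using schreier_generators[OF assms finite_letters letters_closed] by blast
  have "\<exists>us. set us \<subseteq> B \<and> length us = len h \<and> word_product us = h" if h: "h \<in> H" for h
    using len_word[of h] h B(3) subgroup.mem_carrier[OF assms(1) h] by metis
  then show ?thesis using B by blast
qed

lemma finite_index_finitely_generated:
  assumes "subgroup H G" "finite_index G H"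
  obtains B where "finite B" "B \<subseteq> H" "generate G B = H"
proof -
  obtain B where B: "finite B" "B \<subseteq> H"
    "\<And>h. h \<in> H \<Longrightarrow> \<exists>us. set us \<subseteq> B \<and> length us = len h \<and> word_product us = h"
    using finite_index_word_generators[OF assms] by blast
  have "H \<subseteq> generate G B" using B(3) word_product_in_generate by blast
  then show ?thesis
    using that B generate_subgroup_incl[OF B(2) assms(1)] by blast
qed

text \<open>This is the source of the upper bound on growth: an additive map is bounded on the finitely
  many Schreier generators, and an element of length \<open>l\<close> is a product of \<open>l\<close> of them.\<close>
lemma additive_on_finite_index_lipschitz:
  assumes H: "subgroup H G" "finite_index G H" and F: "additive_on G H F"
  obtains C :: nat where "\<And>h. h \<in> H \<Longrightarrow> \<bar>F h\<bar> \<le> real C * real (len h)"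
proof -
  obtain B where B: "finite B" "B \<subseteq> H"
    "\<And>h. h \<in> H \<Longrightarrow> \<exists>us. set us \<subseteq> B \<and> length us = len h \<and> word_product us = h"
    using finite_index_word_generators[OF H] by blast
  define C where "C = nat \<lceil>\<Sum>b\<in>B. \<bar>F b\<bar>\<rceil>"
  have C: "\<bar>F b\<bar> \<le> real C" if "b \<in> B" for b
  proof -
    have "\<bar>F b\<bar> \<le> (\<Sum>b\<in>B. \<bar>F b\<bar>)" by (rule member_le_sum) (use that B in auto)
    then show ?thesis unfolding C_def by linarith
  qed
  have in_H: "word_product us \<in> H" if "set us \<subseteq> B" for us
    using that by (induction us) (use B(2) H(1) in \<open>auto simp: subgroup.one_closed intro: subgroup.m_closed\<close>)
  have "\<bar>F (word_product us)\<bar> \<le> real C * real (length us)" if "set us \<subseteq> B" for us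
    using that
  proof (induction us)
    case Nil
    then show ?case using additive_on_one[OF H(1) F] by simp
  next
    case (Cons b us)
    then have "F (b \<otimes> word_product us) = F b + F (word_product us)"
      using B(2) in_H by (intro additive_onD[OF F]) auto
    then show ?case using Cons C[of b] by (auto simp: algebra_simps)
  qed
  then have "\<bar>F h\<bar> \<le> real C * real (len h)" if "h \<in> H" for h
    using B(3)[OF that] by metis
  then show ?thesis by (rule that)
qed

end

section \<open>Growth of free abelian subgroups and their cosets\<close>

lemma card_coeff_box:
  fixes I :: "'i set"
  assumes "finite I"
  shows "card {c :: 'i \<Rightarrow>\<^sub>0 int. Poly_Mapping.keys c \<subseteq> I \<and> (\<forall>i\<in>I. \<bar>poly_mapping.lookup c i\<bar> \<le> int m)}
    = (2 * m + 1) ^ card I" (is "card ?B = _")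
proof -
  let ?r = "\<lambda>c. restrict (poly_mapping.lookup c) I"
  have "bij_betw ?r ?B (I \<rightarrow>\<^sub>E {- int m..int m})"
  proof (rule bij_betw_imageI)
    show "inj_on ?r ?B"
    proof (rule inj_onI)
      fix c d assume cd: "c \<in> ?B" "d \<in> ?B" "?r c = ?r d"
      show "c = d"
      proof (rule poly_mapping_eqI)
        fix i
        show "poly_mapping.lookup c i = poly_mapping.lookup d i"
        proof (cases "i \<in> I")
          case True
          then show ?thesis using fun_cong[OF cd(3), of i] by simp
        next
          case False
          then have "i \<notin> Poly_Mapping.keys c" "i \<notin> Poly_Mapping.keys d" using cd by auto
          then show ?thesis by (simp add: in_keys_iff)
        qed
      qed
    qed
    show "?r ` ?B = I \<rightarrow>\<^sub>E {- int m..int m}"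
    proof
      show "?r ` ?B \<subseteq> I \<rightarrow>\<^sub>E {- int m..int m}" by fastforce
      show "I \<rightarrow>\<^sub>E {- int m..int m} \<subseteq> ?r ` ?B"
      proof
        fix a assume a: "a \<in> I \<rightarrow>\<^sub>E {- int m..int m}"
        define c where "c = Abs_poly_mapping (\<lambda>i. if i \<in> I then a i else 0)"
        have c: "poly_mapping.lookup c = (\<lambda>i. if i \<in> I then a i else 0)"
          unfolding c_def using assms by (intro lookup_Abs_poly_mapping) (auto elim: finite_subset[rotated])
        have "c \<in> ?B" using a by (auto simp: in_keys_iff c abs_le_iff PiE_iff split: if_splits)
        moreover have "?r c = a" using a by (auto simp: c fun_eq_iff PiE_iff extensional_def)
        ultimately show "a \<in> ?r ` ?B" by blast
      qed
    qed
  qed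
  then have "card ?B = card (I \<rightarrow>\<^sub>E {- int m..int m})"
    by (rule bij_betw_same_card)
  also have "\<dots> = card {- int m..int m} ^ card I"
    using assms by (simp add: card_PiE)
  also have "card {- int m..int m} = 2 * m + 1" by simp
  finally show ?thesis .
qed

context finitely_generated_group
begin

text \<open>The set \<open>J\<close> is separate from \<open>I\<close> so that generators can be split off one at a time while the
  homomorphism stays fixed.\<close>
lemma len_free_hom:
  assumes g: "g \<in> hom (free_Abelian_group I) G" and J: "finite J" "J \<subseteq> I"
    and c: "Poly_Mapping.keys c \<subseteq> J"
  shows "len (g c) \<le> (\<Sum>j\<in>J. nat \<bar>poly_mapping.lookup c j\<bar> * (len (g (frag_of j)) + len (inv (g (frag_of j)))))"
  using J c
proof (induction J arbitrary: c rule: finite_induct)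
  case empty
  interpret g: group_hom "free_Abelian_group I" G g
    using g is_group by (simp add: group_hom_def group_hom_axioms_def)
  show ?case using empty g.hom_one by simp
next
  case (insert j J)
  interpret g: group_hom "free_Abelian_group I" G g
    using g is_group by (simp add: group_hom_def group_hom_axioms_def)
  let ?l = "\<lambda>j. len (g (frag_of j)) + len (inv (g (frag_of j)))"
  define n where "n = poly_mapping.lookup c j"
  define e where "e = c - frag_cmul n (frag_of j)"
  have look: "poly_mapping.lookup e i = (if i = j then 0 else poly_mapping.lookup c i)" for i
    by (simp add: e_def n_def lookup_minus)
  have e: "Poly_Mapping.keys e \<subseteq> J"
    using insert.prems by (auto simp: in_keys_iff look subset_iff split: if_splits)
  have jI: "j \<in> I" and eI: "Poly_Mapping.keys e \<subseteq> I" using insert.prems e by auto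
  have fI: "Poly_Mapping.keys (frag_cmul n (frag_of j)) \<subseteq> I"
    using jI by (auto simp: in_keys_iff split: if_splits)
  have gj: "g (frag_of j) \<in> carrier G" using jI by (auto intro: g.hom_closed)
  have "g c = g (e + frag_cmul n (frag_of j))" by (simp add: e_def)
  also have "\<dots> = g e \<otimes> g (frag_cmul n (frag_of j))"
    using g.hom_mult[of e "frag_cmul n (frag_of j)"] eI fI by auto
  also have "g (frag_cmul n (frag_of j)) = g (frag_of j) [^] n"
    using g.hom_int_pow[of "frag_of j" n] jI by simp
  finally have "len (g c) \<le> len (g e) + len (g (frag_of j) [^] n)"
    using len_mult[of "g e" "g (frag_of j) [^] n"] gj g.hom_closed[of e] eI by simp
  also have "\<dots> \<le> (\<Sum>i\<in>J. nat \<bar>poly_mapping.lookup e i\<bar> * ?l i) + nat \<bar>n\<bar> * ?l j"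
    using insert.IH[OF _ e] insert.prems len_int_pow[OF gj, of n] by (intro add_mono) auto
  also have "(\<Sum>i\<in>J. nat \<bar>poly_mapping.lookup e i\<bar> * ?l i) = (\<Sum>i\<in>J. nat \<bar>poly_mapping.lookup c i\<bar> * ?l i)"
    using insert.hyps by (intro sum.cong) (auto simp: look)
  finally show ?case using insert.hyps by (simp add: n_def)
qed

text \<open>Coefficient vectors bounded by \<open>m\<close> are sent injectively to elements of length at most
  \<open>L * m\<close>, where \<open>L\<close> is the total length of the basis elements and their inverses.\<close>
lemma free_Abelian_subgroup_ball_ge:
  assumes M: "subgroup M G" and g: "g \<in> iso (free_Abelian_group {..<k::nat}) (G\<lparr>carrier := M\<rparr>)"
  obtains L where "\<And>m. (2 * m + 1) ^ k \<le> card {u \<in> M. len u \<le> L * m}"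
proof -
  have hom: "g \<in> hom (free_Abelian_group {..<k}) G"
    and inj: "inj_on g (carrier (free_Abelian_group {..<k}))"
    and img: "g ` carrier (free_Abelian_group {..<k}) = M"
    using g subgroup.subset[OF M] by (auto simp: iso_def hom_def bij_betw_def Pi_def)
  define L where "L = (\<Sum>j<k. len (g (frag_of j)) + len (inv (g (frag_of j))))"
  have "(2 * m + 1) ^ k \<le> card {u \<in> M. len u \<le> L * m}" for m
  proof -
    let ?B = "{c :: nat \<Rightarrow>\<^sub>0 int. Poly_Mapping.keys c \<subseteq> {..<k} \<and> (\<forall>i\<in>{..<k}. \<bar>poly_mapping.lookup c i\<bar> \<le> int m)}"
    have "g ` ?B \<subseteq> {u \<in> M. len u \<le> L * m}"
    proof safe
      fix c :: "nat \<Rightarrow>\<^sub>0 int"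
      assume c: "Poly_Mapping.keys c \<subseteq> {..<k}" "\<forall>i\<in>{..<k}. \<bar>poly_mapping.lookup c i\<bar> \<le> int m"
      show "g c \<in> M" using c(1) img by auto
      have "len (g c) \<le> (\<Sum>j<k. nat \<bar>poly_mapping.lookup c j\<bar> * (len (g (frag_of j)) + len (inv (g (frag_of j)))))"
        by (rule len_free_hom[OF hom _ _ c(1)]) auto
      also have "\<dots> \<le> (\<Sum>j<k. m * (len (g (frag_of j)) + len (inv (g (frag_of j)))))"
        using c(2) by (intro sum_mono mult_right_mono) (auto simp: nat_le_iff)
      also have "\<dots> = L * m" by (simp add: L_def sum_distrib_left mult.commute)
      finally show "len (g c) \<le> L * m" .
    qed
    moreover have "finite {u \<in> M. len u \<le> L * m}"
      by (rule finite_subset[OF _ finite_ball[of "real (L * m)"]])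
        (use subgroup.subset[OF M] in \<open>auto simp del: of_nat_mult\<close>)
    ultimately have "card (g ` ?B) \<le> card {u \<in> M. len u \<le> L * m}"
      by (rule card_mono[rotated])
    moreover have "card (g ` ?B) = card ?B"
      by (rule card_image, rule inj_on_subset[OF inj]) auto
    moreover have "card ?B = (2 * m + 1) ^ k"
      using card_coeff_box[of "{..<k}" m] by simp
    ultimately show ?thesis by simp
  qed
  then show ?thesis by (rule that)
qed

text \<open>The ambient \<open>N\<close> gives control of the coordinates on \<open>M\<close>: \<open>M\<close> may have infinite index in
  \<open>G\<close>, so its coordinates are extended to \<open>N\<close>, where the Lipschitz bound is available.\<close>
lemma free_Abelian_subgroup_ball_le:
  assumes N: "subgroup N G" "finite_index G N" "comm_group (G\<lparr>carrier := N\<rparr>)"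
    and M: "subgroup M G" "M \<subseteq> N"
    and f: "f \<in> iso (G\<lparr>carrier := M\<rparr>) (free_Abelian_group {..<k::nat})"
  obtains C where "\<And>n. card {u \<in> M. len u \<le> n} \<le> (2 * (C * n) + 1) ^ k"
proof -
  let ?A = "G\<lparr>carrier := N\<rparr>"
  interpret A: comm_group ?A by (rule N(3))
  obtain B where B: "finite B" "B \<subseteq> N" "generate G B = N"
    using finite_index_finitely_generated[OF N(1,2)] by blast
  have hom: "f (x \<otimes> y) = f x + f y" if "x \<in> M" "y \<in> M" for x y
    using f that by (auto simp: iso_def hom_def)
  have inj: "inj_on f M" and keys: "\<And>x. x \<in> M \<Longrightarrow> Poly_Mapping.keys (f x) \<subseteq> {..<k}"
    using f by (auto simp: iso_def bij_betw_def hom_def Pi_def)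
  have "\<exists>C::nat. \<forall>u\<in>M. \<bar>real_of_int (poly_mapping.lookup (f u) i)\<bar> \<le> real C * real (len u)" for i
  proof -
    let ?fi = "\<lambda>u. real_of_int (poly_mapping.lookup (f u) i)"
    have "additive_on ?A M ?fi"
      using hom by (auto simp: additive_on_def lookup_add)
    moreover have "subgroup M ?A"
      using subgroup_incl[OF M(1) N(1) M(2)] .
    moreover have "generate ?A B = carrier ?A"
      using generate_consistent[OF B(2) N(1)] B(3) by simp
    ultimately obtain F where F: "additive_on ?A (carrier ?A) F" "\<forall>x\<in>M. F x = ?fi x"
      using A.additive_on_extend B(1) by blast
    then have "additive_on G N F" by (simp add: additive_on_def)
    then obtain C :: nat where "\<And>h. h \<in> N \<Longrightarrow> \<bar>F h\<bar> \<le> real C * real (len h)"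
      using additive_on_finite_index_lipschitz[OF N(1,2)] by blast
    then show ?thesis using F(2) M(2) by (metis subsetD)
  qed
  then obtain C where C: "\<And>i u. u \<in> M \<Longrightarrow> \<bar>real_of_int (poly_mapping.lookup (f u) i)\<bar> \<le> real (C i :: nat) * real (len u)"
    by metis
  define D where "D = (\<Sum>i<k. C i)"
  have CD: "C i \<le> D" if "i < k" for i
    unfolding D_def using that by (intro member_le_sum) auto
  have "card {u \<in> M. len u \<le> n} \<le> (2 * (D * n) + 1) ^ k" for n
  proof -
    let ?B = "{c :: nat \<Rightarrow>\<^sub>0 int. Poly_Mapping.keys c \<subseteq> {..<k} \<and> (\<forall>i\<in>{..<k}. \<bar>poly_mapping.lookup c i\<bar> \<le> int (D * n))}"
    have card_B: "card ?B = (2 * (D * n) + 1) ^ k"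
      using card_coeff_box[of "{..<k}" "D * n"] by simp
    have "f ` {u \<in> M. len u \<le> n} \<subseteq> ?B"
    proof safe
      fix u i assume u: "u \<in> M" "len u \<le> n" and i: "i < k"
      have "real (C i) * real (len u) \<le> real D * real n"
        using CD[OF i] u(2) by (intro mult_mono) auto
      with C[OF u(1), of i] have "real_of_int \<bar>poly_mapping.lookup (f u) i\<bar> \<le> real_of_int (int (D * n))"
        by simp
      then show "\<bar>poly_mapping.lookup (f u) i\<bar> \<le> int (D * n)"
        by (simp only: of_int_le_iff)
    qed (use keys in blast)
    moreover have "finite ?B"
      by (rule card_ge_0_finite) (simp only: card_B, simp)
    moreover have "inj_on f {u \<in> M. len u \<le> n}" by (rule inj_on_subset[OF inj]) auto
    ultimately have "card {u \<in> M. len u \<le> n} \<le> card ?B"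
      by (meson card_inj_on_le)
    then show ?thesis using card_B by simp
  qed
  then show ?thesis by (rule that)
qed

end

context finitely_generated_group
begin

text \<open>A single coset already has the right growth from below, and finitely many cosets multiply the
  upper bound by their number.\<close>
lemma growth_of_union_of_cosets:
  assumes N: "subgroup N G" "finite_index G N" "comm_group (G\<lparr>carrier := N\<rparr>)"
    and M: "subgroup M G" "M \<subseteq> N"
    and iso: "G\<lparr>carrier := M\<rparr> \<cong> free_Abelian_group {..<k::nat}"
    and T: "finite T" "T \<subseteq> carrier G" "t\<^sub>0 \<in> T"
    and U: "U = (\<Union>t\<in>T. M #> t)"
  shows "(\<lambda>r. real (subset_growth G S U r)) \<in> \<Theta>(\<lambda>r. r ^ k)"
proof -
  interpret M: subgroup M G by (rule M(1))
  have t0: "t\<^sub>0 \<in> carrier G" using T by auto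
  obtain f where f: "f \<in> iso (G\<lparr>carrier := M\<rparr>) (free_Abelian_group {..<k})"
    using iso by (auto simp: is_iso_def)
  obtain g where g: "g \<in> iso (free_Abelian_group {..<k}) (G\<lparr>carrier := M\<rparr>)"
    using group.iso_sym[OF M.subgroup_is_group[OF is_group] iso] by (auto simp: is_iso_def)
  obtain C where C: "\<And>n. card {u \<in> M. len u \<le> n} \<le> (2 * (C * n) + 1) ^ k"
    using free_Abelian_subgroup_ball_le[OF N M f] by blast
  obtain L where L: "\<And>m. (2 * m + 1) ^ k \<le> card {u \<in> M. len u \<le> L * m}"
    using free_Abelian_subgroup_ball_ge[OF M(1) g] by blast
  have UG: "U \<subseteq> carrier G" using U T r_coset_subset_G[OF M.subset] by blast
  have finU: "finite {u \<in> U. real (len u) \<le> r}" for r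
    by (rule finite_subset[OF _ finite_ball[of r]]) (use UG in auto)
  have finM: "finite {u \<in> M. len u \<le> n}" for n
    by (rule finite_subset[OF _ finite_ball[of "real n"]]) auto
  define D where "D = (\<Sum>t\<in>T. len (inv t))"
  have D: "len (inv t) \<le> D" if "t \<in> T" for t
    unfolding D_def using that T by (intro member_le_sum) auto
  define K where "K = 2 * (C * (1 + D)) + 1"
  have upper: "real (subset_growth G S U r) \<le> real (card T) * real K ^ k * r ^ k" if r: "r \<ge> 1" for r
  proof -
    define n where "n = nat \<lfloor>r\<rfloor>"
    have n: "len u \<le> n" if "real (len u) \<le> r" for u
      using that by (simp add: n_def le_nat_floor)
    have nr: "real n \<le> r" using r by (simp add: n_def)
    have "{u \<in> U. real (len u) \<le> r} \<subseteq> (\<Union>t\<in>T. (\<lambda>v. v \<otimes> t) ` {v \<in> M. len v \<le> n + D})"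
    proof safe
      fix u assume u: "u \<in> U" "real (len u) \<le> r"
      then obtain t v where t: "t \<in> T" and v: "v \<in> M" "u = v \<otimes> t"
        using U by (auto simp: r_coset_def)
      have tG: "t \<in> carrier G" using t T by auto
      have uG: "u \<in> carrier G" using u UG by auto
      have "v = u \<otimes> inv t" using v tG by (simp add: m_assoc)
      then have "len v \<le> len u + len (inv t)" using len_mult[of u "inv t"] uG tG by simp
      then have "len v \<le> n + D" using n[OF u(2)] D[OF t] by linarith
      then show "u \<in> (\<Union>t\<in>T. (\<lambda>v. v \<otimes> t) ` {v \<in> M. len v \<le> n + D})" using t v by blast
    qed
    then have "subset_growth G S U r \<le> card (\<Union>t\<in>T. (\<lambda>v. v \<otimes> t) ` {v \<in> M. len v \<le> n + D})"
      unfolding subset_growth_def using T finM by (intro card_mono) auto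
    also have "\<dots> \<le> (\<Sum>t\<in>T. card ((\<lambda>v. v \<otimes> t) ` {v \<in> M. len v \<le> n + D}))"
      by (rule card_UN_le[OF T(1)])
    also have "\<dots> \<le> (\<Sum>t\<in>T. (2 * (C * (n + D)) + 1) ^ k)"
      by (intro sum_mono le_trans[OF card_image_le[OF finM] C])
    also have "\<dots> = card T * (2 * (C * (n + D)) + 1) ^ k" by simp
    finally have "real (subset_growth G S U r) \<le> real (card T * (2 * (C * (n + D)) + 1) ^ k)"
      by (simp only: of_nat_le_iff)
    also have "\<dots> = real (card T) * (2 * (real C * (real n + real D)) + 1) ^ k"
      by (simp add: add.commute)
    also have "\<dots> \<le> real (card T) * (real K * r) ^ k"
    proof (intro mult_left_mono power_mono)
      have "real n + real D \<le> (1 + real D) * r"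
        using nr mult_left_mono[OF r, of "real D"] by (simp add: algebra_simps)
      from mult_left_mono[OF this, of "2 * real C"] r
      show "2 * (real C * (real n + real D)) + 1 \<le> real K * r"
        by (simp add: K_def algebra_simps)
    qed auto
    finally show ?thesis by (simp add: power_mult_distrib mult.assoc)
  qed
  \<comment> \<open>For \<open>r \<ge> 2 len t\<^sub>0\<close> at least \<open>r / 2\<close> remains after paying for the translation by \<open>t\<^sub>0\<close>;
    the summand 1 prevents division by zero when \<open>M\<close> is trivial.\<close>
  define c where "c = 1 / (2 * (real L + 1))"
  have c: "c > 0" by (simp add: c_def)
  have lower: "c ^ k * r ^ k \<le> real (subset_growth G S U r)" if r: "r \<ge> 2 * real (len t\<^sub>0)" for r
  proof -
    define m where "m = nat \<lfloor>(r - real (len t\<^sub>0)) / (real L + 1)\<rfloor>"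
    have nonneg: "0 \<le> (r - real (len t\<^sub>0)) / (real L + 1)" using r by simp
    have "real m \<le> (r - real (len t\<^sub>0)) / (real L + 1)" using nonneg by (simp add: m_def)
    then have "real m * (real L + 1) \<le> r - real (len t\<^sub>0)" by (simp add: field_simps)
    then have small: "real L * real m + real (len t\<^sub>0) \<le> r" by (simp add: algebra_simps)
    have "(r - real (len t\<^sub>0)) / (real L + 1) < real m + 1"
      using nonneg unfolding m_def by linarith
    moreover have "c * r \<le> (r - real (len t\<^sub>0)) / (real L + 1)"
    proof -
      have "c * r = (r / 2) / (real L + 1)" by (simp add: c_def)
      also have "\<dots> \<le> (r - real (len t\<^sub>0)) / (real L + 1)"
        using r by (intro divide_right_mono) auto
      finally show ?thesis .
    qed
    ultimately have "c * r \<le> real (2 * m + 1)" by simp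
    moreover have "0 \<le> c * r" using c r by simp
    ultimately have "(c * r) ^ k \<le> real (2 * m + 1) ^ k" by (intro power_mono)
    also have "\<dots> \<le> real (card {u \<in> M. len u \<le> L * m})"
      using L[of m] by (simp only: of_nat_le_iff flip: of_nat_power)
    also have "card {u \<in> M. len u \<le> L * m} = card ((\<lambda>v. v \<otimes> t\<^sub>0) ` {u \<in> M. len u \<le> L * m})"
      by (rule card_image[symmetric], rule inj_on_subset[OF inj_on_multc[OF t0]]) auto
    also have "\<dots> \<le> subset_growth G S U r"
      unfolding subset_growth_def
    proof (rule card_mono[OF finU])
      show "(\<lambda>v. v \<otimes> t\<^sub>0) ` {u \<in> M. len u \<le> L * m} \<subseteq> {u \<in> U. real (len u) \<le> r}"
      proof safe
        fix v assume v: "v \<in> M" "len v \<le> L * m"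
        show "v \<otimes> t\<^sub>0 \<in> U" using v T U by (auto simp: r_coset_def)
        have "len (v \<otimes> t\<^sub>0) \<le> L * m + len t\<^sub>0"
          using len_mult[of v t\<^sub>0] v t0 by auto
        then have "real (len (v \<otimes> t\<^sub>0)) \<le> real (L * m + len t\<^sub>0)" by (simp only: of_nat_le_iff)
        then show "real (len (v \<otimes> t\<^sub>0)) \<le> r" using small by simp
      qed
    qed
    finally show ?thesis by (simp add: power_mult_distrib)
  qed
  show ?thesis
  proof (rule bigthetaI)
    show "(\<lambda>r. real (subset_growth G S U r)) \<in> O(\<lambda>r. r ^ k)"
    proof (rule bigoI)
      show "\<forall>\<^sub>F r in at_top. norm (real (subset_growth G S U r)) \<le> real (card T) * real K ^ k * norm (r ^ k)"
        using eventually_ge_at_top[of "1::real"] by eventually_elim (use upper in simp)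
    qed
    show "(\<lambda>r. real (subset_growth G S U r)) \<in> \<Omega>(\<lambda>r. r ^ k)"
    proof (rule landau_omega.bigI[of "c ^ k"])
      show "\<forall>\<^sub>F r in at_top. c ^ k * norm (r ^ k) \<le> norm (real (subset_growth G S U r))"
        using eventually_ge_at_top[of "2 * real (len t\<^sub>0)"] eventually_ge_at_top[of "0::real"]
        by eventually_elim (use lower in simp)
    qed (use c in simp)
  qed
qed

end

section \<open>Twisted conjugacy classes\<close>

lemma (in group) induced_endo_coset:
  assumes N: "N \<lhd> G" and \<phi>: "\<phi> \<in> hom G G" "\<phi> ` N \<subseteq> N" and x: "x \<in> carrier G"
  shows "induced_endo G N \<phi> (N #> x) = N #> \<phi> x"
proof -
  interpret N: normal N G by (rule N)
  have "(\<lambda>y. N #> \<phi> y) ` (N #> x) = {N #> \<phi> x}"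
  proof -
    have "N #> \<phi> y = N #> \<phi> x" if y: "y \<in> N #> x" for y
    proof -
      obtain n where n: "n \<in> N" "y = n \<otimes> x" using y by (auto simp: r_coset_def)
      have "\<phi> y = \<phi> n \<otimes> \<phi> x" using \<phi>(1) n x by (simp add: hom_mult)
      moreover have "\<phi> n \<in> N" using \<phi>(2) n by auto
      moreover have "\<phi> x \<in> carrier G" using \<phi>(1) x by (rule hom_in_carrier)
      ultimately show ?thesis
        using coset_mult_assoc[OF N.subset, of "\<phi> n" "\<phi> x"] coset_join2[OF _ N.is_subgroup, of "\<phi> n"] by simp
    qed
    moreover have "x \<in> N #> x" using rcos_self[OF x N.is_subgroup] .
    ultimately show ?thesis by blast
  qed
  then show ?thesis by (simp add: induced_endo_def)
qed

text \<open>In the abelian quotient \<open>G/N\<close> the class of \<open>\<phi> t\<close> is that of \<open>t\<close>, so the two outer factors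
  cancel.\<close>
lemma (in group) twisted_shift_mem_coset:
  assumes N: "N \<lhd> G" and comm: "comm_group (G Mod N)"
    and \<phi>: "\<phi> \<in> hom G G" "\<phi> ` N \<subseteq> N"
    and ind: "\<forall>C\<in>carrier (G Mod N). induced_endo G N \<phi> C = C"
    and g: "g \<in> carrier G" and t: "t \<in> carrier G"
  shows "t \<otimes> g \<otimes> inv (\<phi> t) \<in> N #> g"
proof -
  interpret N: normal N G by (rule N)
  interpret Q: comm_group "G Mod N" by (rule comm)
  have \<phi>t: "\<phi> t \<in> carrier G" using \<phi>(1) t by (rule hom_in_carrier)
  have mem: "N #> x \<in> carrier (G Mod N)" if "x \<in> carrier G" for x
    using that by (auto simp: FactGroup_def RCOSETS_def)
  have "N #> \<phi> t = N #> t"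
    using ind mem[OF t] induced_endo_coset[OF N \<phi> t] by simp
  then have "N #> (t \<otimes> g) = N #> (g \<otimes> \<phi> t)"
    using Q.m_comm[OF mem[OF t] mem[OF g]] N.rcos_sum[OF t g] N.rcos_sum[OF g t] N.rcos_sum[OF g \<phi>t]
    by simp
  then have "N #> (t \<otimes> g) #> inv (\<phi> t) = N #> (g \<otimes> \<phi> t) #> inv (\<phi> t)" by simp
  then have "N #> (t \<otimes> g \<otimes> inv (\<phi> t)) = N #> (g \<otimes> \<phi> t \<otimes> inv (\<phi> t))"
    using t g \<phi>t by (simp add: coset_mult_assoc N.subset)
  then have "N #> (t \<otimes> g \<otimes> inv (\<phi> t)) = N #> g"
    using g \<phi>t by (simp add: m_assoc)
  then show ?thesis
    using rcos_self[OF _ N.is_subgroup, of "t \<otimes> g \<otimes> inv (\<phi> t)"] t g \<phi>t by simp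
qed

lemma (in group) twisted_difference_hom:
  assumes N: "N \<lhd> G" and comm: "comm_group (G\<lparr>carrier := N\<rparr>)"
    and \<phi>: "\<phi> \<in> hom G G" "\<phi> ` N \<subseteq> N" and g: "g \<in> carrier G"
  shows "endo_diff G id (inner_aut G g \<circ> \<phi>) \<in> hom (G\<lparr>carrier := N\<rparr>) (G\<lparr>carrier := N\<rparr>)"
proof (rule homI)
  interpret N: normal N G by (rule N)
  interpret A: comm_group "G\<lparr>carrier := N\<rparr>" by (rule comm)
  let ?\<psi> = "endo_diff G id (inner_aut G g \<circ> \<phi>)"
  let ?\<tau> = "\<lambda>x. inner_aut G g (\<phi> x)"
  have \<tau>: "?\<tau> x \<in> N" if "x \<in> N" for x
    using that \<phi>(2) N.inv_op_closed2[OF g] by (auto simp: inner_aut_def)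
  show "?\<psi> x \<in> carrier (G\<lparr>carrier := N\<rparr>)" if "x \<in> carrier (G\<lparr>carrier := N\<rparr>)" for x
    using that \<tau> by (simp add: endo_diff_def)
  show "?\<psi> (x \<otimes>\<^bsub>G\<lparr>carrier := N\<rparr>\<^esub> y) = ?\<psi> x \<otimes>\<^bsub>G\<lparr>carrier := N\<rparr>\<^esub> ?\<psi> y"
    if "x \<in> carrier (G\<lparr>carrier := N\<rparr>)" "y \<in> carrier (G\<lparr>carrier := N\<rparr>)" for x y
  proof -
    have xy: "x \<in> N" "y \<in> N" using that by auto
    have c: "a \<otimes> b = b \<otimes> a" if "a \<in> N" "b \<in> N" for a b
      using A.m_comm that by simp
    have fx: "\<phi> x \<in> carrier G" "\<phi> y \<in> carrier G" using xy \<phi> by auto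
    have "?\<tau> (x \<otimes> y) = ?\<tau> x \<otimes> ?\<tau> y"
    proof -
      have "?\<tau> x \<otimes> ?\<tau> y = g \<otimes> \<phi> x \<otimes> (inv g \<otimes> g) \<otimes> \<phi> y \<otimes> inv g"
        unfolding inner_aut_def using fx g by (simp only: m_assoc m_closed inv_closed)
      then show ?thesis
        using fx g xy \<phi>(1) by (simp add: inner_aut_def hom_mult m_assoc)
    qed
    then have "inv (?\<tau> (x \<otimes> y)) = inv (?\<tau> x) \<otimes> inv (?\<tau> y)"
      using \<tau>[OF xy(1)] \<tau>[OF xy(2)] c by (simp add: inv_mult_group)
    moreover have "x \<otimes> y \<otimes> (a \<otimes> b) = x \<otimes> a \<otimes> (y \<otimes> b)" if "a \<in> N" "b \<in> N" for a b
    proof -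
      have "x \<otimes> y \<otimes> (a \<otimes> b) = x \<otimes> (y \<otimes> a) \<otimes> b" using xy that by (simp add: m_assoc)
      also have "y \<otimes> a = a \<otimes> y" using xy that c by simp
      finally show ?thesis using xy that by (simp add: m_assoc)
    qed
    ultimately show ?thesis using xy \<tau> by (simp add: endo_diff_def)
  qed
qed

text \<open>Twisting \<open>g\<close> by \<open>n \<otimes> t\<close> amounts to twisting \<open>a = t \<otimes> g \<otimes> inv (\<phi> t)\<close> by \<open>n\<close>.  Since \<open>a = x \<otimes> g\<close>
  with \<open>x \<in> N\<close> and \<open>N\<close> is abelian, conjugation by \<open>a\<close> on \<open>N\<close> is conjugation by \<open>g\<close>, and the
  result is \<open>a\<close> multiplied by the twisted difference of \<open>n\<close>, formed with \<open>g\<close> itself.\<close>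
lemma (in group) twisted_class_eq_union_of_cosets:
  assumes N: "N \<lhd> G" and commN: "comm_group (G\<lparr>carrier := N\<rparr>)" and comm: "comm_group (G Mod N)"
    and \<phi>: "\<phi> \<in> hom G G" "\<phi> ` N \<subseteq> N"
    and ind: "\<forall>C\<in>carrier (G Mod N). induced_endo G N \<phi> C = C"
    and g: "g \<in> carrier G"
    and R: "R \<subseteq> carrier G" "carrier G \<subseteq> (\<Union>t\<in>R. N #> t)"
  shows "twisted_class G \<phi> g =
    (\<Union>a\<in>(\<lambda>t. t \<otimes> g \<otimes> inv (\<phi> t)) ` R. endo_diff G id (inner_aut G g \<circ> \<phi>) ` N #> a)"
proof -
  interpret N: normal N G by (rule N)
  interpret A: comm_group "G\<lparr>carrier := N\<rparr>" by (rule commN)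
  interpret \<phi>: group_hom G G \<phi>
    using \<phi>(1) is_group by (simp add: group_hom_def group_hom_axioms_def)
  let ?\<psi> = "endo_diff G id (inner_aut G g \<circ> \<phi>)"
  have c: "a \<otimes> b = b \<otimes> a" if "a \<in> N" "b \<in> N" for a b
    using A.m_comm that by simp
  have key: "(n \<otimes> t) \<otimes> g \<otimes> inv (\<phi> (n \<otimes> t)) = ?\<psi> n \<otimes> (t \<otimes> g \<otimes> inv (\<phi> t))"
    if n: "n \<in> N" and t: "t \<in> carrier G" for n t
  proof -
    obtain x where x: "x \<in> N" "t \<otimes> g \<otimes> inv (\<phi> t) = x \<otimes> g"
      using twisted_shift_mem_coset[OF N comm \<phi> ind g t] by (auto simp: r_coset_def)
    have nG: "n \<in> carrier G" "\<phi> n \<in> carrier G" "x \<in> carrier G" using n x by auto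
    define y where "y = g \<otimes> inv (\<phi> n) \<otimes> inv g"
    have y: "y \<in> N" "y \<in> carrier G"
      using n \<phi>(2) N.inv_op_closed2[OF g] by (auto simp: y_def)
    have \<psi>n: "?\<psi> n = n \<otimes> y"
      using nG g by (simp add: endo_diff_def inner_aut_def y_def inv_mult_group m_assoc)
    have "(n \<otimes> t) \<otimes> g \<otimes> inv (\<phi> (n \<otimes> t)) = n \<otimes> (t \<otimes> g \<otimes> inv (\<phi> t)) \<otimes> inv (\<phi> n)"
      using nG t g by (simp add: inv_mult_group m_assoc)
    also have "\<dots> = n \<otimes> (x \<otimes> y) \<otimes> g"
      using x nG g by (simp add: y_def m_assoc)
    also have "x \<otimes> y = y \<otimes> x" using c x y by simp
    also have "n \<otimes> (y \<otimes> x) \<otimes> g = ?\<psi> n \<otimes> (x \<otimes> g)"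
      using nG g y by (simp add: \<psi>n m_assoc)
    finally show ?thesis using x by simp
  qed
  show ?thesis
  proof (intro equalityI subsetI)
    fix u assume "u \<in> twisted_class G \<phi> g"
    then obtain z where z: "z \<in> carrier G" "u = z \<otimes> g \<otimes> inv (\<phi> z)"
      by (auto simp: twisted_class_def twisted_conjugate_def)
    then obtain n t where nt: "t \<in> R" "n \<in> N" "z = n \<otimes> t"
      using R(2) by (auto simp: r_coset_def)
    then have "u = ?\<psi> n \<otimes> (t \<otimes> g \<otimes> inv (\<phi> t))"
      using key[of n t] z R(1) by blast
    then have "u \<in> ?\<psi> ` N #> (t \<otimes> g \<otimes> inv (\<phi> t))"
      using nt(2) unfolding r_coset_def by blast
    then show "u \<in> (\<Union>a\<in>(\<lambda>t. t \<otimes> g \<otimes> inv (\<phi> t)) ` R. ?\<psi> ` N #> a)"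
      using nt(1) by blast
  next
    fix u assume "u \<in> (\<Union>a\<in>(\<lambda>t. t \<otimes> g \<otimes> inv (\<phi> t)) ` R. ?\<psi> ` N #> a)"
    then obtain n t where nt: "t \<in> R" "n \<in> N" "u = ?\<psi> n \<otimes> (t \<otimes> g \<otimes> inv (\<phi> t))"
      by (auto simp: r_coset_def)
    then have u: "u = (n \<otimes> t) \<otimes> g \<otimes> inv (\<phi> (n \<otimes> t))" and "n \<otimes> t \<in> carrier G"
      using key[of n t] R(1) by auto
    then show "u \<in> twisted_class G \<phi> g"
      using g by (auto simp: twisted_class_def twisted_conjugate_def simp del: \<phi>.hom_mult)
  qed
qed

lemma (in group) finite_index_representatives:
  assumes H: "subgroup H G" and fin: "finite_index G H"
  obtains R where "finite R" "R \<subseteq> carrier G" "carrier G \<subseteq> (\<Union>t\<in>R. H #> t)"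
proof -
  have "\<exists>t\<in>carrier G. C = H #> t" if "C \<in> rcosets H" for C
    using that by (auto simp: RCOSETS_def)
  then obtain r where r: "\<And>C. C \<in> rcosets H \<Longrightarrow> r C \<in> carrier G \<and> C = H #> r C"
    by metis
  show ?thesis
  proof (rule that)
    show "finite (r ` (rcosets H))" using fin by (simp add: finite_index_def)
    show "r ` (rcosets H) \<subseteq> carrier G" using r by auto
    show "carrier G \<subseteq> (\<Union>t\<in>r ` (rcosets H). H #> t)"
    proof
      fix x assume x: "x \<in> carrier G"
      then have "H #> x \<in> rcosets H" by (auto simp: RCOSETS_def)
      then show "x \<in> (\<Union>t\<in>r ` (rcosets H). H #> t)"
        using r rcos_self[OF x H] by blast
    qed
  qed
qed

section \<open>Growth of twisted conjugacy classes\<close>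

theorem theorem5:
  fixes G :: "('a, 'b) monoid_scheme" (structure)
    and S N :: "'a set" and \<phi> :: "'a \<Rightarrow> 'a" and g\<^sub>0 :: 'a
  assumes "group G"
    and "finitely_generated G"
    and "virtually_abelian G"
    and "finite_generating_set G S"
    and "N \<lhd> G"
    and "comm_group (G\<lparr>carrier := N\<rparr>)"
    and "torsion_free (G\<lparr>carrier := N\<rparr>)"
    and "finite_index G N"
    and "\<phi> \<in> hom G G"
    and "\<phi> ` N \<subseteq> N"
    and "comm_group (G Mod N)"
    and "\<forall>C\<in>carrier (G Mod N). induced_endo G N \<phi> C = C"
    and "g\<^sub>0 \<in> carrier G"
  shows "(\<lambda>r::real. real (subset_growth G S (twisted_class G \<phi> g\<^sub>0) r)) \<in>
    \<Theta>(\<lambda>r. r ^ endo_rank G N (endo_diff G id (inner_aut G g\<^sub>0 \<circ> \<phi>)))"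
proof -
  interpret finitely_generated_group G S
    using assms(1,4) by (simp add: finitely_generated_group_def finitely_generated_group_axioms_def)
  interpret N: normal N G by (rule assms(5))
  let ?A = "G\<lparr>carrier := N\<rparr>"
  interpret A: comm_group ?A by (rule assms(6))
  define \<psi> where "\<psi> = endo_diff G id (inner_aut G g\<^sub>0 \<circ> \<phi>)"
  define M where "M = \<psi> ` N"
  let ?M = "G\<lparr>carrier := M\<rparr>"
  interpret \<psi>: group_hom ?A ?A \<psi>
    using twisted_difference_hom[OF assms(5,6,9,10,13)] A.is_group
    by (simp add: group_hom_def group_hom_axioms_def \<psi>_def)
  have MN: "M \<subseteq> N" using \<psi>.hom_closed by (auto simp: M_def)
  have MA: "subgroup M ?A" using \<psi>.img_is_subgroup by (simp add: M_def)
  have MG: "subgroup M G" using incl_subgroup[OF N.is_subgroup MA] .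
  obtain B where B: "finite B" "B \<subseteq> N" "generate G B = N"
    using finite_index_finitely_generated[OF N.is_subgroup assms(8)] by blast
  have "generate ?A B = N" using generate_consistent[OF B(2) N.is_subgroup] B(3) by simp
  then have "generate ?A (\<psi> ` B) = M"
    using \<psi>.generate_img[of B] B(2) by (simp add: M_def)
  moreover have sub: "\<psi> ` B \<subseteq> M" using B(2) by (auto simp: M_def)
  ultimately have gen: "generate ?M (\<psi> ` B) = carrier ?M"
    using generate_consistent[OF _ N.is_subgroup, of "\<psi> ` B"] generate_consistent[OF sub MG] MN by simp
  \<comment> \<open>\<open>M\<close> is generated by the image of a finite generating set of \<open>N\<close>, and inherits
    commutativity and torsion-freeness from \<open>N\<close>.\<close>
  have "comm_group ?M"
    using A.m_comm MN by (intro group.group_comm_groupI subgroup.subgroup_is_group[OF MG is_group]) auto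
  moreover have "torsion_free ?M"
    using assms(7) MN by (auto simp: torsion_free_def simp flip: nat_pow_consistent)
  ultimately obtain k where k: "?M \<cong> free_Abelian_group {..<k::nat}"
    using comm_group.fin_gen_torsion_free_imp_free[OF _ _ _ gen] B(1) by blast
  then have rank: "endo_rank G N \<psi> = k"
    using free_rank_eqI[OF subgroup.subgroup_is_group[OF MG is_group] k]
    by (simp add: endo_rank_def M_def)
  obtain R where R: "finite R" "R \<subseteq> carrier G" "carrier G \<subseteq> (\<Union>t\<in>R. N #> t)"
    using finite_index_representatives[OF N.is_subgroup assms(8)] .
  let ?T = "(\<lambda>t. t \<otimes> g\<^sub>0 \<otimes> inv (\<phi> t)) ` R"
  have "R \<noteq> {}" using R(3) by auto
  then obtain t\<^sub>0 where "t\<^sub>0 \<in> ?T" by blast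
  moreover have "?T \<subseteq> carrier G"
    using R(2) assms(13) hom_in_carrier[OF assms(9)] by auto
  moreover have "twisted_class G \<phi> g\<^sub>0 = (\<Union>t\<in>?T. M #> t)"
    using twisted_class_eq_union_of_cosets[OF assms(5,6,11,9,10,12,13) R(2,3)]
    by (simp add: M_def \<psi>_def)
  ultimately have "(\<lambda>r. real (subset_growth G S (twisted_class G \<phi> g\<^sub>0) r)) \<in> \<Theta>(\<lambda>r. r ^ k)"
    using R(1) by (intro growth_of_union_of_cosets[OF N.is_subgroup assms(8,6) MG MN k]) auto
  then show ?thesis using rank by (simp add: \<psi>_def)
qed

end
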